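(* For every $k\ge1$ and every tree poset $T$ on $k$ elements, the poset $\mathcal{T}^k$ rainbow forces $T$.
   Context: All posets are finite. The Hasse diagram of a poset has an edge between $x,y$ whenever one covers the other; a tree poset is a poset whose Hasse diagram is a tree. A copy of $P$ in $Q$ is a subset of $Q$ which with the induced order is isomorphic to $P$. A coloring of a poset is proper if comparable distinct elements get distinct colors; a copy is rainbow if its elements get pairwise distinct colors; $Q$ rainbow forces $P$ if every proper coloring of $Q$ admits a rainbow copy of $P$. The comparability graph $CG(P)$ has vertex set $P$, with $x,y$ adjacent iff they are comparable. The rank $r(x)$ of an element: minimal elements have rank 1, and iteratively the minimal elements of what remains after removing elements of rank $<j$ have rank $j$. $D^{k,h}$ is the poset whose Hasse diagram is the complete $k$-ary rooted tree of height $h$ (i.e. $h$ vertices on a longest root-to-leaf path), ordered so that each node is larger than its children (the root is the largest element); $U^{k,h}$ is its dual (the root is the smallest element); $D^k=D^{k,k}$. The poset $\mathcal{T}^k$ is built as follows. Take a copy of $D^k$; its root $x$ will be the central element of $\mathcal{T}^k$ (rank $k$), and its other elements are called down elements. To every such down element $y$ of rank $r$, append a copy of $U^{k,k-r+1}$ by identifying $y$ with the root of this uptree (so elements at distance $d$ above $y$ in it have rank $r+d$); the newly added elements are up elements. Continue: to every newly created up element $z$ of rank $r$ append a copy of $D^{k,r}$ identifying $z$ with its root (new elements are down elements), and to every newly created down element $z$ of rank $r$ append a copy of $U^{k,k-r+1}$ identifying $z$ with its root (new elements are up elements). Stop after $k$ steps, when the radius of $CG(\mathcal{T}^k)$ becomes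 $k$. The result is a tree poset of height $k$ all of whose maximal chains have $k$ elements. *)

theory Defs
  imports Main "HOL-Library.Sublist"
begin

text \<open>
  A poset is a relation \<open>r\<close> with \<open>Partial_order r\<close>; its elements are \<open>Field r\<close>, and
  \<open>(x, y) \<in> r\<close> means \<open>x \<le> y\<close>.
\<close>

definition covers :: "'a rel \<Rightarrow> 'a \<Rightarrow> 'a \<Rightarrow> bool" where
  "covers r y x \<longleftrightarrow> (x, y) \<in> r \<and> x \<noteq> y \<and>
     \<not> (\<exists>z. z \<noteq> x \<and> z \<noteq> y \<and> (x, z) \<in> r \<and> (z, y) \<in> r)"

definition hasse_edges :: "'a rel \<Rightarrow> 'a rel" where
  "hasse_edges r = {(x, y). covers r x y \<or> covers r y x}"

text \<open>
  Simple graphs are given by a vertex set and a symmetric irreflexive edge relation. (The constant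
  \<open>tree\<close> of the AFP entry Graph Theory forbids directed cycles, so it is not the notion needed
  here: a symmetric digraph has a directed cycle on each edge, while an oriented Hasse diagram
  never has one.)
\<close>

definition graph_cycle :: "'a rel \<Rightarrow> 'a list \<Rightarrow> bool" where
  "graph_cycle E xs \<longleftrightarrow> 3 \<le> length xs \<and> distinct xs \<and>
     (\<forall>i < length xs. (xs ! i, xs ! (Suc i mod length xs)) \<in> E)"

definition graph_tree :: "'a set \<Rightarrow> 'a rel \<Rightarrow> bool" where
  "graph_tree V E \<longleftrightarrow> V \<noteq> {} \<and> (\<forall>x\<in>V. \<forall>y\<in>V. (x, y) \<in> E\<^sup>*) \<and> \<not> (\<exists>xs. graph_cycle E xs)"

definition tree_poset :: "'a rel \<Rightarrow> bool" where
  "tree_poset r \<longleftrightarrow> Partial_order r \<and> finite (Field r) \<and> graph_tree (Field r) (hasse_edges r)"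

definition poset_iso :: "('a \<Rightarrow> 'b) \<Rightarrow> 'a rel \<Rightarrow> 'b rel \<Rightarrow> bool" where
  "poset_iso f r s \<longleftrightarrow> bij_betw f (Field r) (Field s) \<and>
     (\<forall>x\<in>Field r. \<forall>y\<in>Field r. (x, y) \<in> r \<longleftrightarrow> (f x, f y) \<in> s)"

definition is_copy :: "'b set \<Rightarrow> 'a rel \<Rightarrow> 'b rel \<Rightarrow> bool" where
  "is_copy S p q \<longleftrightarrow> S \<subseteq> Field q \<and> (\<exists>f. poset_iso f p (Restr q S))"

definition proper_coloring :: "'a rel \<Rightarrow> ('a \<Rightarrow> 'c) \<Rightarrow> bool" where
  "proper_coloring q c \<longleftrightarrow> (\<forall>x y. (x, y) \<in> q \<and> x \<noteq> y \<longrightarrow> c x \<noteq> c y)"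

text \<open>Colors are natural numbers, which is no restriction since posets are finite.\<close>

definition rainbow_forces :: "'b rel \<Rightarrow> 'a rel \<Rightarrow> bool" where
  "rainbow_forces q p \<longleftrightarrow>
     (\<forall>c :: 'b \<Rightarrow> nat. proper_coloring q c \<longrightarrow> (\<exists>S. is_copy S p q \<and> inj_on c S))"

definition minimal_elements :: "'a rel \<Rightarrow> 'a set \<Rightarrow> 'a set" where
  "minimal_elements r A = {x \<in> A. \<forall>y\<in>A. (y, x) \<in> r \<longrightarrow> y = x}"

text \<open>\<open>remaining r j\<close> is what is left after removing the elements of rank at most \<open>j\<close>.\<close>

fun remaining :: "'a rel \<Rightarrow> nat \<Rightarrow> 'a set" where
  "remaining r 0 = Field r"
| "remaining r (Suc j) = remaining r j - minimal_elements r (remaining r j)"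

definition rank :: "'a rel \<Rightarrow> 'a \<Rightarrow> nat" where
  "rank r x = (LEAST j. x \<notin> remaining r j)"

text \<open>
  The complete \<open>k\<close>-ary rooted tree of height \<open>h\<close> has as nodes the words of length less than \<open>h\<close>
  over \<open>{..<k}\<close>: the root is \<open>[]\<close>, and the children of \<open>w\<close> are the words \<open>w @ [i]\<close>.
\<close>

definition kary_nodes :: "nat \<Rightarrow> nat \<Rightarrow> nat list set" where
  "kary_nodes k h = {w. length w < h \<and> set w \<subseteq> {..<k}}"

definition Dtree :: "nat \<Rightarrow> nat \<Rightarrow> nat list rel" where
  "Dtree k h = {(v, w). v \<in> kary_nodes k h \<and> w \<in> kary_nodes k h \<and> prefix w v}"

definition Utree :: "nat \<Rightarrow> nat \<Rightarrow> nat list rel" where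
  "Utree k h = (Dtree k h)\<inverse>"

text \<open>
  Elements of \<open>\<T>\<^sup>k\<close> are named by lists of words. The central element is \<open>[]\<close>. When a tree is
  appended to \<open>y\<close>, its root is identified with \<open>y\<close> and its node \<open>w \<noteq> []\<close> becomes the new element
  \<open>y @ [w]\<close>.
\<close>

type_synonym elem = "nat list list"

definition glue :: "elem \<Rightarrow> nat list \<Rightarrow> elem" where
  "glue y w = (if w = [] then y else y @ [w])"

definition append_at :: "elem \<Rightarrow> nat list rel \<Rightarrow> elem rel" where
  "append_at y s = map_prod (glue y) (glue y) ` s"

text \<open>
  \<open>stage k n\<close> is the poset after \<open>n\<close> steps, where step 1 creates \<open>D\<^sup>k\<close>. The elements created in an
  odd step are all down elements and those created in an even step are all up elements, so the
  steps alternate between appending uptrees and downtrees. The order after a step is the one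
  generated by the old order and the orders of the appended trees. For \<open>k \<ge> 2\<close>, the eccentricity
  of the central element in the comparability graph after \<open>n\<close> steps is \<open>n\<close>, so \<open>k\<close> steps in total
  give radius \<open>k\<close>.
\<close>

fun stage :: "nat \<Rightarrow> nat \<Rightarrow> elem rel" where
  "stage k 0 = {([], [])}"
| "stage k (Suc 0) = append_at [] (Dtree k k)"
| "stage k (Suc (Suc n)) =
     (let R = stage k (Suc n); new = Field R - Field (stage k n)
      in (R \<union> (\<Union>y\<in>new. append_at y
                 (if even n then Utree k (k - rank R y + 1) else Dtree k (rank R y))))\<^sup>+)"

definition Tposet :: "nat \<Rightarrow> elem rel" where
  "Tposet k = stage k k"

end

theory Submission
  imports Defs
begin

text \<open>
  Every maximal chain of \<open>\<T>\<^sup>k\<close> has \<open>k\<close> elements, hence \<open>k\<close> colours. Place the vertices of \<open>T\<close> one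
  at a time, starting with a maximal vertex at the central element. When \<open>t\<close> is to be placed above
  an already placed neighbour and \<open>a\<close> unplaced vertices lie above \<open>t\<close>, go up a fresh branch until
  exactly \<open>a\<close> unused colours remain on the worst chain above. Then every chain below \<open>t\<close> still
  contains at least as many unused colours as there are unplaced vertices not above \<open>t\<close>. The vertices
  above \<open>t\<close> are placed next; their colours occur above \<open>t\<close>, hence never below it, so from then on
  every chain below \<open>t\<close> has an unused colour for each unplaced vertex, and this persists because
  each placement uses up one colour and one vertex. Down steps are dual.
\<close>

subsection \<open>Hasse diagrams of tree posets\<close>

text \<open>Upward and downward arguments are dual throughout; a Boolean direction lets one proof
  treat both. \<open>True\<close> stands for up.\<close>

definition dir :: "bool \<Rightarrow> 'a rel \<Rightarrow> 'a rel" where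
  "dir d r = (if d then r else r\<inverse>)"

lemma dir_not: "(x, y) \<in> dir (\<not> d) r \<longleftrightarrow> (y, x) \<in> dir d r"
  by (auto simp: dir_def)

lemma dir_trancl: "dir d (r\<^sup>+) = (dir d r)\<^sup>+"
  by (simp add: dir_def trancl_converse)

lemma trans_dir: "trans r \<Longrightarrow> trans (dir d r)"
  by (simp add: dir_def)

text \<open>Whenever the walk returns to a vertex of the path built so far, the path is cut off at
  that vertex.\<close>

lemma rtrancl_simple_path:
  assumes "(a, b) \<in> R\<^sup>*"
  obtains xs where "xs \<noteq> []" "hd xs = a" "last xs = b" "distinct xs"
    "\<And>i. Suc i < length xs \<Longrightarrow> (xs ! i, xs ! Suc i) \<in> R"
proof -
  have "\<exists>xs. xs \<noteq> [] \<and> hd xs = a \<and> last xs = b \<and> distinct xs \<and>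
    (\<forall>i. Suc i < length xs \<longrightarrow> (xs ! i, xs ! Suc i) \<in> R)"
    using assms
  proof (induction rule: rtrancl_induct)
    case base
    show ?case by (rule exI[of _ "[a]"]) auto
  next
    case (step y z)
    then obtain xs where xs: "xs \<noteq> []" "hd xs = a" "last xs = y" "distinct xs"
      "\<forall>i. Suc i < length xs \<longrightarrow> (xs ! i, xs ! Suc i) \<in> R" by blast
    show ?case
    proof (cases "z \<in> set xs")
      case True
      then obtain i where i: "i < length xs" "xs ! i = z" by (auto simp: in_set_conv_nth)
      have "last (take (Suc i) xs) = z" using i by (simp add: take_Suc_conv_app_nth)
      then show ?thesis using xs i
        by (intro exI[of _ "take (Suc i) xs"]) auto
    next
      case False
      have "(xs @ [z]) ! i = xs ! i" if "i < length xs" for i using that by (simp add: nth_append)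
      moreover have "((xs @ [z]) ! i, (xs @ [z]) ! Suc i) \<in> R" if "Suc i < length (xs @ [z])" for i
      proof (cases "Suc i < length xs")
        case True
        then show ?thesis using xs by (simp add: nth_append)
      next
        case False
        then have "i = length xs - 1" "Suc i = length xs" using that by auto
        then show ?thesis using xs step.hyps(2) by (simp add: nth_append last_conv_nth)
      qed
      ultimately show ?thesis using xs False by (intro exI[of _ "xs @ [z]"]) auto
    qed
  qed
  then show thesis using that by blast
qed

text \<open>A simple path from \<open>a\<close> to \<open>b\<close> that avoids \<open>t\<close>
  closes up through \<open>t\<close>. Since \<open>a\<close> and \<open>b\<close> differ, the cycle
  has at least three vertices.\<close>

lemma graph_cycle_through:
  assumes "sym E" "(t, a) \<in> E" "(t, b) \<in> E" "a \<noteq> b" "(a, b) \<in> (Restr E (- {t}))\<^sup>*"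
  shows "\<exists>xs. graph_cycle E xs"
proof -
  obtain xs where xs: "xs \<noteq> []" "hd xs = a" "last xs = b" "distinct xs"
    "\<And>i. Suc i < length xs \<Longrightarrow> (xs ! i, xs ! Suc i) \<in> Restr E (- {t})"
    using rtrancl_simple_path[OF assms(5)] by metis
  have len: "2 \<le> length xs"
    using xs(1-3) assms(4) by (cases xs; cases "tl xs") auto
  have ab: "xs ! 0 = a" "xs ! (length xs - 1) = b"
    using xs by (simp_all add: hd_conv_nth last_conv_nth)
  have "xs ! i \<noteq> t" if "i < length xs" for i
  proof (cases i)
    case 0
    then show ?thesis using xs(5)[of 0] len by auto
  next
    case (Suc j)
    then show ?thesis using xs(5)[of j] that by auto
  qed
  then have "t \<notin> set xs" by (auto simp: in_set_conv_nth)
  moreover have "((t # xs) ! i, (t # xs) ! (Suc i mod length (t # xs))) \<in> E"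
    if i: "i < length (t # xs)" for i
  proof -
    consider "i = 0" | "i = length xs" | j where "i = Suc j" "Suc j < length xs"
      using i by (cases i) (auto simp: less_Suc_eq)
    then show ?thesis
    proof cases
      case 1
      then show ?thesis using assms(2) ab xs(1) by simp
    next
      case 2
      then show ?thesis using assms(1,3) ab xs(1) by (simp add: sym_def nth_Cons')
    next
      case 3
      then show ?thesis using xs(5)[of j] by simp
    qed
  qed
  ultimately show ?thesis using xs(4) len by (intro exI[of _ "t # xs"]) (simp add: graph_cycle_def)
qed

section \<open>Hasse diagrams, duality and covers in finite posets\<close>

lemma sym_hasse_edges: "sym (hasse_edges r)"
  by (auto simp: sym_def hasse_edges_def)

lemma covers_converse: "covers (r\<inverse>) y x \<longleftrightarrow> covers r x y"
  by (auto simp: covers_def)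

lemma hasse_edges_converse: "hasse_edges (r\<inverse>) = hasse_edges r"
  by (auto simp: hasse_edges_def covers_converse)

lemma hasse_edges_dir: "hasse_edges (dir d r) = hasse_edges r"
  by (simp add: dir_def hasse_edges_converse)

lemma tree_poset_dir: "tree_poset r \<Longrightarrow> tree_poset (dir d r)"
  by (auto simp: tree_poset_def dir_def hasse_edges_converse)

lemma Field_dir [simp]: "Field (dir d r) = Field r"
  by (simp add: dir_def)

text \<open>An element of \<open>A\<close> with the fewest elements above it works, because moving
  to a strictly larger element shrinks the set above.\<close>

lemma exists_maximal:
  assumes "Partial_order r" "finite (Field r)" "A \<subseteq> Field r" "A \<noteq> {}"
  obtains m where "m \<in> A" "\<And>y. y \<in> A \<Longrightarrow> (m, y) \<in> r \<Longrightarrow> y = m"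
proof -
  have tr: "trans r" and an: "antisym r" and re: "Refl r"
    using assms(1) by (auto simp: order_on_defs)
  let ?n = "\<lambda>z. card {u. (z, u) \<in> r}"
  obtain m where m: "m \<in> A" "\<And>y. y \<in> A \<Longrightarrow> ?n m \<le> ?n y"
    using assms(4) ex_has_least_nat[of "\<lambda>x. x \<in> A" _ ?n] by blast
  have "y = m" if y: "y \<in> A" "(m, y) \<in> r" for y
  proof (rule ccontr)
    assume "y \<noteq> m"
    then have "(m, m) \<in> r" "(y, m) \<notin> r"
      using y m(1) assms(3) an re by (auto simp: refl_on_def dest: antisymD)
    then have "{u. (y, u) \<in> r} \<subset> {u. (m, u) \<in> r}"
      using y(2) transD[OF tr] by blast
    moreover have "finite {u. (m, u) \<in> r}"
      by (rule finite_subset[OF _ assms(2)]) (auto simp: Field_def)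
    ultimately have "?n y < ?n m" by (rule psubset_card_mono[rotated])
    with m(2)[OF y(1)] show False by simp
  qed
  with m(1) show thesis by (rule that)
qed

text \<open>Take a maximal element among those that are at least \<open>x\<close> and strictly below
  \<open>y\<close>.\<close>

lemma exists_lower_cover:
  assumes "Partial_order r" "finite (Field r)" "(x, y) \<in> r" "x \<noteq> y"
  obtains z where "(x, z) \<in> r" "covers r y z"
proof -
  have tr: "trans r" and an: "antisym r" and re: "Refl r"
    using assms(1) by (auto simp: order_on_defs)
  let ?A = "{z. (x, z) \<in> r \<and> (z, y) \<in> r \<and> z \<noteq> y}"
  have "x \<in> ?A" "?A \<subseteq> Field r"
    using assms re by (auto simp: refl_on_def Field_def)
  then obtain z where z: "z \<in> ?A" "\<And>u. u \<in> ?A \<Longrightarrow> (z, u) \<in> r \<Longrightarrow> u = z"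
    using exists_maximal[OF assms(1,2), of ?A] by blast
  moreover have "(x, u) \<in> r" if "(z, u) \<in> r" for u
    using z(1) that transD[OF tr] by blast
  ultimately show thesis using that unfolding covers_def by blast
qed

text \<open>Descend from \<open>y\<close> through lower covers that stay above \<open>x\<close>.
  Confinement to the interval is what later shows that such a path avoids a given vertex.\<close>

lemma hasse_path_below:
  assumes "Partial_order r" "finite (Field r)" "(x, y) \<in> r"
  shows "(x, y) \<in> (Restr (hasse_edges r) {z. (x, z) \<in> r \<and> (z, y) \<in> r})\<^sup>*"
  using assms(3)
proof (induction "card {u. (u, y) \<in> r}" arbitrary: y rule: less_induct)
  case less
  have tr: "trans r" and an: "antisym r" and re: "Refl r"
    using assms(1) by (auto simp: order_on_defs)
  show ?case
  proof (cases "x = y")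
    case False
    then obtain z where z: "(x, z) \<in> r" "covers r y z"
      using exists_lower_cover[OF assms(1,2) less.prems] by blast
    have zy: "(z, y) \<in> r" "z \<noteq> y" using z by (auto simp: covers_def)
    have fin: "finite {u. (u, y) \<in> r}"
      by (rule finite_subset[OF _ assms(2)]) (auto simp: Field_def)
    have "(y, y) \<in> r" "(y, z) \<notin> r"
      using zy an re by (auto simp: refl_on_def Field_def dest: antisymD)
    then have "{u. (u, z) \<in> r} \<subset> {u. (u, y) \<in> r}"
      using zy(1) transD[OF tr] by blast
    then have "card {u. (u, z) \<in> r} < card {u. (u, y) \<in> r}" by (rule psubset_card_mono[OF fin])
    from less.hyps[OF this z(1)]
    have "(x, z) \<in> (Restr (hasse_edges r) {u. (x, u) \<in> r \<and> (u, z) \<in> r})\<^sup>*" .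
    then have "(x, z) \<in> (Restr (hasse_edges r) {u. (x, u) \<in> r \<and> (u, y) \<in> r})\<^sup>*"
      by (rule rtrancl_mono[THEN subsetD, rotated]) (use zy transD[OF tr] in blast)
    moreover have "(z, y) \<in> Restr (hasse_edges r) {u. (x, u) \<in> r \<and> (u, y) \<in> r}"
      using z zy less.prems re by (auto simp: hasse_edges_def refl_on_def Field_def)
    ultimately show ?thesis by (rule rtrancl.rtrancl_into_rtrancl)
  qed simp
qed

text \<open>The edge to \<open>s\<close> is the only way from \<open>t\<close> into the connected
  set \<open>P\<close>, as a second one would close a cycle. A comparability between
  \<open>t\<close> and \<open>p\<close> gives a Hasse path that leaves \<open>t\<close> through a
  cover and does not return, so this cover must be \<open>s\<close>.\<close>

lemma tree_poset_attach:
  assumes T: "tree_poset r" and P: "\<forall>x\<in>P. \<forall>y\<in>P. (x, y) \<in> (Restr (hasse_edges r) P)\<^sup>*"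
    and s: "s \<in> P" and t: "t \<notin> P" "covers r t s" and p: "p \<in> P"
  shows "(p, t) \<in> r \<longleftrightarrow> (p, s) \<in> r" and "(t, p) \<notin> r"
proof -
  have po: "Partial_order r" and fin: "finite (Field r)"
    and nc: "\<not> (\<exists>xs. graph_cycle (hasse_edges r) xs)"
    using T by (auto simp: tree_poset_def graph_tree_def)
  have tr: "trans r" and an: "antisym r"
    using po by (auto simp: order_on_defs)
  have st: "(s, t) \<in> r" "s \<noteq> t" using t by (auto simp: covers_def)
  have ps: "(p, s) \<in> (Restr (hasse_edges r) (- {t}))\<^sup>*"
    using P p s t(1) by (blast intro: rtrancl_mono[THEN subsetD, rotated])
  have eq: "z = s" if z: "(t, z) \<in> hasse_edges r" "(z, p) \<in> (Restr (hasse_edges r) (- {t}))\<^sup>*" for z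
  proof (rule ccontr)
    assume "z \<noteq> s"
    moreover have "(t, s) \<in> hasse_edges r" using t by (auto simp: hasse_edges_def)
    ultimately show False
      using graph_cycle_through[OF sym_hasse_edges z(1)] rtrancl_trans[OF z(2) ps] nc by blast
  qed
  show "(p, t) \<in> r \<longleftrightarrow> (p, s) \<in> r"
  proof
    assume pt: "(p, t) \<in> r"
    have "p \<noteq> t" using p t by auto
    then obtain z where z: "(p, z) \<in> r" "covers r t z"
      using exists_lower_cover[OF po fin pt] by blast
    have "(p, z) \<in> (Restr (hasse_edges r) (- {t}))\<^sup>*"
      by (rule rtrancl_mono[THEN subsetD, OF _ hasse_path_below[OF po fin z(1)]])
        (use z an in \<open>auto simp: covers_def dest: antisymD\<close>)
    moreover have "sym (Restr (hasse_edges r) (- {t}))"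
      using sym_hasse_edges[of r] by (auto simp: sym_def)
    ultimately have "(z, p) \<in> (Restr (hasse_edges r) (- {t}))\<^sup>*"
      by (meson sym_rtrancl symD)
    moreover have "(t, z) \<in> hasse_edges r" using z by (auto simp: hasse_edges_def)
    ultimately show "(p, s) \<in> r" using eq z(1) by blast
  next
    assume "(p, s) \<in> r"
    then show "(p, t) \<in> r" using st tr by (blast dest: transD)
  qed
  show "(t, p) \<notin> r"
  proof
    assume tp: "(t, p) \<in> r"
    have "p \<noteq> t" using p t by auto
    \<comment> \<open>In the dual order the lower cover becomes an upper cover of \<open>t\<close>.
      Uniqueness of the exit identifies it with \<open>s\<close>, which lies below
      \<open>t\<close>.\<close>
    have "Partial_order (r\<inverse>)" "finite (Field (r\<inverse>))" using po fin by auto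
    from exists_lower_cover[OF this, of p t] tp \<open>p \<noteq> t\<close>
    obtain z where z: "(z, p) \<in> r" "covers r z t" by (auto simp: covers_converse)
    have "(z, p) \<in> (Restr (hasse_edges r) (- {t}))\<^sup>*"
      by (rule rtrancl_mono[THEN subsetD, OF _ hasse_path_below[OF po fin z(1)]])
        (use z an in \<open>auto simp: covers_def dest: antisymD\<close>)
    moreover have "(t, z) \<in> hasse_edges r" using z by (auto simp: hasse_edges_def)
    ultimately have "z = s" using eq by blast
    then show False using z(2) st an by (auto simp: covers_def dest: antisymD)
  qed
qed

subsection \<open>The order and the ranks of the stages\<close>

text \<open>A closed form for the rank. The central element starts at \<open>k\<close>; words at
  even indices lead down, those at odd indices lead up. Integer values avoid truncated
  subtraction.\<close>

definition rho :: "nat \<Rightarrow> elem \<Rightarrow> int" where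
  "rho k e = int k + (\<Sum>i<length e. (if odd i then 1 else - 1) * int (length (e ! i)))"

lemma rho_Nil [simp]: "rho k [] = int k"
  by (simp add: rho_def)

lemma rho_snoc [simp]:
  "rho k (e @ [w]) = rho k e + (if odd (length e) then int (length w) else - int (length w))"
  by (simp add: rho_def nth_append)

text \<open>The names that occur in some stage. Bounding \<open>rho\<close> amounts to requiring
  that each word fits into the tree appended at the preceding prefix; the number of words is bounded
  separately, by the stage.\<close>

inductive valid :: "nat \<Rightarrow> elem \<Rightarrow> bool" for k where
  Nil: "1 \<le> k \<Longrightarrow> valid k []"
| snoc: "\<lbrakk>valid k e; w \<noteq> []; set w \<subseteq> {..<k}; 1 \<le> rho k (e @ [w]); rho k (e @ [w]) \<le> int k\<rbrakk>
    \<Longrightarrow> valid k (e @ [w])"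

lemma valid_snoc_iff:
  "valid k (e @ [w]) \<longleftrightarrow> valid k e \<and> w \<noteq> [] \<and> set w \<subseteq> {..<k} \<and>
     1 \<le> rho k (e @ [w]) \<and> rho k (e @ [w]) \<le> int k"
  by (auto intro: valid.snoc elim: valid.cases)

lemma valid_rho: "valid k e \<Longrightarrow> 1 \<le> rho k e \<and> rho k e \<le> int k"
  by (induction rule: valid.induct) auto

text \<open>The largest word length in the tree appended to \<open>b\<close>, one less than its
  height in the sense of \<open>Utree\<close> and \<open>Dtree\<close>. A name of odd length is a
  down element, so its tree grows upwards.\<close>

definition hgt :: "nat \<Rightarrow> elem \<Rightarrow> nat" where
  "hgt k b = nat (if odd (length b) then int k - rho k b else rho k b - 1)"

lemma valid_glue_iff:
  "valid k (glue b w) \<longleftrightarrow> valid k b \<and> set w \<subseteq> {..<k} \<and> length w \<le> hgt k b"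
  using valid_rho[of k b] by (auto simp: glue_def valid_snoc_iff hgt_def)

lemma rho_glue:
  "rho k (glue b w) = rho k b + (if odd (length b) then int (length w) else - int (length w))"
  by (simp add: glue_def)

text \<open>The generating relation: comparabilities inside a single appended tree with root
  \<open>b\<close>. Its transitive closure turns out to be stage \<open>n\<close>.\<close>

definition tree_pairs :: "nat \<Rightarrow> nat \<Rightarrow> elem rel" where
  "tree_pairs k n = {(x, y). \<exists>b v w. x = glue b v \<and> y = glue b w \<and>
     valid k x \<and> valid k y \<and> length x \<le> n \<and> length y \<le> n \<and>
     (if odd (length b) then prefix v w else prefix w v)}"

lemma tree_pairs_refl: "valid k x \<Longrightarrow> length x \<le> n \<Longrightarrow> (x, x) \<in> tree_pairs k n"
  unfolding tree_pairs_def by (auto intro!: exI[of _ x] exI[of _ "[] :: nat list"] simp: glue_def)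

lemma tree_pairs_mono: "m \<le> n \<Longrightarrow> tree_pairs k m \<subseteq> tree_pairs k n"
  unfolding tree_pairs_def by fastforce

lemma tree_pairs_valid:
  "(x, y) \<in> tree_pairs k n \<Longrightarrow> valid k x \<and> valid k y \<and> length x \<le> n \<and> length y \<le> n"
  by (auto simp: tree_pairs_def)

lemma Field_tree_pairs: "Field ((tree_pairs k n)\<^sup>+) = {x. valid k x \<and> length x \<le> n}"
proof -
  have "Field ((tree_pairs k n)\<^sup>+) = Field (tree_pairs k n)"
    by (simp add: Field_def trancl_domain trancl_range)
  then show ?thesis by (auto simp: Field_def dest: tree_pairs_valid intro: tree_pairs_refl)
qed

text \<open>Proper prefixes are shorter, so each nontrivial generating pair raises
  \<open>rho\<close>. This gives antisymmetry of the closure and one half of the computation of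
  ranks.\<close>

lemma rho_strict_mono:
  assumes "(x, y) \<in> (tree_pairs k n)\<^sup>+"
  shows "x = y \<or> rho k x < rho k y"
proof -
  have pre: "v = w \<or> length v < length w" if "prefix v w" for v w :: "nat list"
    using that by (auto simp: prefix_def)
  have *: "x = y \<or> rho k x < rho k y" if xy: "(x, y) \<in> tree_pairs k n" for x y
  proof -
    obtain b v w where b: "x = glue b v" "y = glue b w" "if odd (length b) then prefix v w else prefix w v"
      using xy by (auto simp: tree_pairs_def)
    show ?thesis
    proof (cases "odd (length b)")
      case True
      then show ?thesis using b pre[of v w] by (auto simp: rho_glue)
    next
      case False
      then show ?thesis using b pre[of w v] by (auto simp: rho_glue)
    qed
  qed
  from assms show ?thesis
  proof (induction rule: trancl_induct)
    case (base y)
    then show ?case by (rule *)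
  next
    case (step y z)
    then show ?case using *[of y z] by force
  qed
qed

section \<open>Ranks of the elements\<close>

lemma glue_butlast_last: "e \<noteq> [] \<Longrightarrow> last e \<noteq> [] \<Longrightarrow> glue (butlast e) (last e) = e"
  by (simp add: glue_def)

lemma valid_last: "valid k e \<Longrightarrow> e \<noteq> [] \<Longrightarrow> last e \<noteq> []"
  by (auto elim: valid.cases)

lemma glue_Nil [simp]: "glue b [] = b"
  by (simp add: glue_def)

lemma length_glue: "length (glue b w) = (if w = [] then length b else Suc (length b))"
  by (simp add: glue_def)

text \<open>In a downtree append the letter 0, in an uptree drop the last letter. Only the central
  element needs a new word, hence the bound \<open>Suc n\<close> instead of
  \<open>n\<close>.\<close>

lemma exists_lower_neighbour:
  assumes "valid k x" "length x \<le> Suc n" "1 < rho k x"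
  shows "\<exists>y. (y, x) \<in> tree_pairs k (Suc n) \<and> rho k y = rho k x - 1"
proof (cases "x = []")
  case True
  then have "2 \<le> k" using assms by simp
  then have "valid k [[0]]"
    using valid_glue_iff[of k "[]" "[0]"] assms True by (simp add: glue_def hgt_def)
  then show ?thesis using True assms
    unfolding tree_pairs_def
    by (intro exI[of _ "[[0]]"])
      (auto simp: rho_def glue_def intro!: exI[of _ "[] :: elem"] exI[of _ "[] :: nat list"] exI[of _ "[0] :: nat list"])
next
  case False
  define b w where "b = butlast x" and "w = last x"
  have x: "x = b @ [w]" "w \<noteq> []" "x = glue b w" using False valid_last[OF assms(1)]
    by (auto simp: b_def w_def glue_def)
  have k: "0 < k" using valid_rho[OF assms(1)] by linarith
  have val: "valid k b" "set w \<subseteq> {..<k}" "length w \<le> hgt k b"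
    using assms(1) x(3) valid_glue_iff by auto
  show ?thesis
  proof (cases "odd (length b)")
    case True
    have "valid k (glue b (butlast w))" using val
      by (auto simp: valid_glue_iff dest: in_set_butlastD)
    moreover have "length (glue b (butlast w)) \<le> Suc n" using x assms by (auto simp: length_glue)
    moreover have "rho k (glue b (butlast w)) = rho k x - 1"
      using True x by (auto simp: rho_glue of_nat_diff Suc_le_eq)
    moreover have "prefix (butlast w) w" by (simp add: prefixeq_butlast)
    ultimately have "(glue b (butlast w), glue b w) \<in> tree_pairs k (Suc n)"
      "rho k (glue b (butlast w)) = rho k x - 1"
      using True assms x(3) unfolding tree_pairs_def by auto
    then show ?thesis using x(3) by blast
  next
    case False
    have "valid k (glue b (w @ [0]))" using val k assms(3) x False
      by (auto simp: valid_glue_iff hgt_def)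
    moreover have "length (glue b (w @ [0])) \<le> Suc n" using x assms by (auto simp: length_glue)
    moreover have "rho k (glue b (w @ [0])) = rho k x - 1"
      using False x by (auto simp: rho_glue)
    ultimately show ?thesis using False assms x unfolding tree_pairs_def
      by (intro exI[of _ "glue b (w @ [0])"]) fastforce
  qed
qed

text \<open>Of the elements with \<open>rho\<close> above \<open>j\<close>, those of value
  \<open>j + 1\<close> are minimal by strict monotonicity; all others have a remaining neighbour one
  step lower.\<close>

lemma remaining_tree_pairs:
  "remaining ((tree_pairs k (Suc n))\<^sup>+) j = {x. valid k x \<and> length x \<le> Suc n \<and> int j < rho k x}"
proof (induction j)
  case 0
  show ?case by (auto simp: Field_tree_pairs dest: valid_rho)
next
  case (Suc j)
  let ?R = "(tree_pairs k (Suc n))\<^sup>+"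
  have "minimal_elements ?R {x. valid k x \<and> length x \<le> Suc n \<and> int j < rho k x}
    = {x. valid k x \<and> length x \<le> Suc n \<and> rho k x = int j + 1}" (is "?L = ?M")
  proof (intro equalityI subsetI)
    fix x assume x: "x \<in> ?L"
    show "x \<in> ?M"
    proof (rule ccontr)
      assume "x \<notin> ?M"
      then have *: "int j + 1 < rho k x" using x by (auto simp: minimal_elements_def)
      then obtain y where y: "(y, x) \<in> tree_pairs k (Suc n)" "rho k y = rho k x - 1"
        using exists_lower_neighbour[of k x n] x by (auto simp: minimal_elements_def)
      then have "y = x" using x * tree_pairs_valid[OF y(1)] unfolding minimal_elements_def by fastforce
      then show False using y by simp
    qed
  next
    fix x assume "x \<in> ?M"
    then show "x \<in> ?L" using rho_strict_mono[of _ x k "Suc n"] unfolding minimal_elements_def by fastforce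
  qed
  then show ?case using Suc by auto
qed

lemma rank_tree_pairs:
  assumes "valid k x" "length x \<le> Suc n"
  shows "rank ((tree_pairs k (Suc n))\<^sup>+) x = nat (rho k x)"
  unfolding rank_def remaining_tree_pairs
  using assms valid_rho[OF assms(1)] by (intro Least_equality) auto

section \<open>Identification of the stages with the generated orders\<close>

lemma append_at_Utree:
  "append_at b (Utree k (h + 1)) = {(x, y). \<exists>v w. x = glue b v \<and> y = glue b w \<and>
     set v \<subseteq> {..<k} \<and> set w \<subseteq> {..<k} \<and> length v \<le> h \<and> length w \<le> h \<and> prefix v w}"
  unfolding append_at_def Utree_def Dtree_def kary_nodes_def by (force simp: image_iff less_Suc_eq_le)

lemma append_at_Dtree:
  "append_at b (Dtree k (h + 1)) = {(x, y). \<exists>v w. x = glue b v \<and> y = glue b w \<and>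
     set v \<subseteq> {..<k} \<and> set w \<subseteq> {..<k} \<and> length v \<le> h \<and> length w \<le> h \<and> prefix w v}"
  unfolding append_at_def Dtree_def kary_nodes_def by (force simp: image_iff less_Suc_eq_le)

definition tree_at :: "nat \<Rightarrow> elem \<Rightarrow> elem rel" where
  "tree_at k b = {(x, y). \<exists>v w. x = glue b v \<and> y = glue b w \<and>
     valid k x \<and> valid k y \<and> (if odd (length b) then prefix v w else prefix w v)}"

lemma append_at_tree:
  assumes "valid k b"
  shows "append_at b (if odd (length b) then Utree k (k - nat (rho k b) + 1)
      else Dtree k (nat (rho k b))) = tree_at k b"
proof (cases "odd (length b)")
  case True
  then have "k - nat (rho k b) + 1 = hgt k b + 1"
    using valid_rho[OF assms] by (auto simp: hgt_def)
  with True show ?thesis using assms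
    by (simp only: append_at_Utree if_True not_False_eq_True tree_at_def) (force simp: valid_glue_iff)
next
  case False
  then have "nat (rho k b) = hgt k b + 1"
    using valid_rho[OF assms] by (auto simp: hgt_def)
  with False show ?thesis using assms
    by (simp only: append_at_Dtree if_False tree_at_def) (force simp: valid_glue_iff)
qed

lemma tree_at_subset:
  assumes "length b < n"
  shows "tree_at k b \<subseteq> tree_pairs k n"
  using assms unfolding tree_pairs_def tree_at_def by (fastforce simp: length_glue)

lemma tree_pairs_Suc_subset:
  "tree_pairs k (Suc n) \<subseteq> tree_pairs k n \<union> (\<Union>b\<in>{b. valid k b \<and> length b = n}. tree_at k b)"
proof (rule subrelI)
  fix x y assume xy: "(x, y) \<in> tree_pairs k (Suc n)"
  then obtain b v w where b: "x = glue b v" "y = glue b w" "valid k x" "valid k y"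
    "length x \<le> Suc n" "length y \<le> Suc n" "if odd (length b) then prefix v w else prefix w v"
    by (auto simp: tree_pairs_def)
  consider "length x \<le> n" "length y \<le> n" | "length b = n" | "length b = Suc n" "v = []" "w = []"
    using b(1,2,5,6) by (cases "length b < n"; cases "length b = n") (auto simp: length_glue split: if_splits)
  then show "(x, y) \<in> tree_pairs k n \<union> (\<Union>b\<in>{b. valid k b \<and> length b = n}. tree_at k b)"
  proof cases
    case 1
    then show ?thesis using b unfolding tree_pairs_def by blast
  next
    case 2
    moreover have "valid k b" using b by (simp add: valid_glue_iff)
    ultimately show ?thesis using b unfolding tree_at_def by blast
  next
    case 3
    \<comment> \<open>A reflexive pair at an element with \<open>Suc n\<close> words. It also
      belongs to the tree in which that element was created, whose root is
      \<open>butlast b\<close>.\<close>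
    then have "b \<noteq> []" "x = b" "y = b" using b by auto
    then have "x = glue (butlast b) (last b)" "y = glue (butlast b) (last b)"
      "length (butlast b) = n" "valid k (butlast b)"
      using valid_last[of k b] b 3 glue_butlast_last[of b] valid_glue_iff[of k "butlast b" "last b"] by auto
    then show ?thesis using b by (intro UnI2 UN_I[of "butlast b"]) (auto simp: tree_at_def)
  qed
qed

text \<open>The new elements of a stage are the names with the maximal number of words. Their ranks
  are given by \<open>rho\<close>, so the trees appended to them are exactly the
  \<open>tree_at k b\<close>.\<close>

lemma stage_eq:
  assumes "1 \<le> k"
  shows "stage k n = (tree_pairs k n)\<^sup>+"
  using assms
proof (induction k n rule: stage.induct)
  case (1 k)
  have "tree_pairs k 0 = {([], [])}"
    using valid.Nil[OF 1] unfolding tree_pairs_def by (auto intro: exI[of _ "[]"] simp: glue_def)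
  then show ?case by (auto elim: trancl.induct)
next
  case (2 k)
  have "append_at [] (Dtree k k) = tree_at k []"
    using append_at_tree[OF valid.Nil[OF 2]] by simp
  moreover have "tree_pairs k (Suc 0) = tree_at k []"
  proof
    show "tree_at k [] \<subseteq> tree_pairs k (Suc 0)" by (rule tree_at_subset) simp
    have "tree_pairs k 0 \<subseteq> tree_at k []" unfolding tree_pairs_def tree_at_def by (auto simp: glue_def)
    then show "tree_pairs k (Suc 0) \<subseteq> tree_at k []" using tree_pairs_Suc_subset[of k 0] by auto
  qed
  \<comment> \<open>The first step takes no transitive closure, so this single tree must already be
    transitive.\<close>
  moreover have "trans (tree_at k [])"
    unfolding tree_at_def
    by (rule transI) (auto simp: glue_def split: if_splits dest: prefix_order.trans)
  ultimately show ?case by (simp add: trancl_id)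
next
  case (3 k n)
  have R: "stage k (Suc n) = (tree_pairs k (Suc n))\<^sup>+" and R0: "stage k n = (tree_pairs k n)\<^sup>+"
    using 3 by auto
  let ?new = "{b. valid k b \<and> length b = Suc n}"
  have new: "Field (stage k (Suc n)) - Field (stage k n) = ?new"
    unfolding R R0 Field_tree_pairs by auto
  have A: "append_at y (if even n then Utree k (k - rank (stage k (Suc n)) y + 1)
      else Dtree k (rank (stage k (Suc n)) y)) = tree_at k y" if "y \<in> ?new" for y
  proof -
    have "rank (stage k (Suc n)) y = nat (rho k y)"
      unfolding R using that by (intro rank_tree_pairs) auto
    moreover have "even n \<longleftrightarrow> odd (length y)" using that by auto
    ultimately show ?thesis using append_at_tree[of k y] that by (cases "even n") auto
  qed
  have "(\<Union>y\<in>?new. append_at y (if even n then Utree k (k - rank (stage k (Suc n)) y + 1)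
      else Dtree k (rank (stage k (Suc n)) y))) = (\<Union>b\<in>?new. tree_at k b)"
    using A by (intro SUP_cong refl)
  then have "stage k (Suc (Suc n)) = ((tree_pairs k (Suc n))\<^sup>+ \<union> (\<Union>b\<in>?new. tree_at k b))\<^sup>+"
    by (simp only: stage.simps Let_def new[unfolded R] R)
  also have "\<dots> = (tree_pairs k (Suc (Suc n)))\<^sup>+" (is "?L\<^sup>+ = ?M\<^sup>+")
  proof
    have "(tree_pairs k (Suc n))\<^sup>+ \<subseteq> ?M\<^sup>+"
      using tree_pairs_mono[of "Suc n" "Suc (Suc n)" k] by (intro subrelI) (auto intro: trancl_mono)
    moreover have "(\<Union>b\<in>?new. tree_at k b) \<subseteq> ?M\<^sup>+"
    proof (rule UN_least)
      fix b assume "b \<in> ?new"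
      then have "tree_at k b \<subseteq> ?M" by (intro tree_at_subset) simp
      then show "tree_at k b \<subseteq> ?M\<^sup>+" by (rule order_trans) (auto intro: r_into_trancl)
    qed
    ultimately have "?L \<subseteq> ?M\<^sup>+" by blast
    then have "?L\<^sup>+ \<subseteq> (?M\<^sup>+)\<^sup>+" using trancl_mono by (intro subsetI) blast
    then show "?L\<^sup>+ \<subseteq> ?M\<^sup>+" by (simp add: trancl_id)
    have "?M \<subseteq> tree_pairs k (Suc n) \<union> (\<Union>b\<in>?new. tree_at k b)"
      by (rule tree_pairs_Suc_subset)
    also have "\<dots> \<subseteq> ?L" by (rule Un_mono) (auto intro: r_into_trancl)
    finally have "?M \<subseteq> ?L" .
    then show "?M\<^sup>+ \<subseteq> ?L\<^sup>+" using trancl_mono by (intro subsetI) blast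
  qed
  finally show ?case .
qed

subsection \<open>Branches of the appended trees\<close>

lemma dir_tree_pairs:
  "(x, y) \<in> dir d (tree_pairs k n) \<longleftrightarrow> (\<exists>b v w. x = glue b v \<and> y = glue b w \<and>
     valid k x \<and> valid k y \<and> length x \<le> n \<and> length y \<le> n \<and>
     (if odd (length b) = d then prefix v w else prefix w v))"
proof (cases d)
  case True
  then show ?thesis by (simp add: dir_def tree_pairs_def)
next
  case False
  have "(x, y) \<in> dir d (tree_pairs k n) \<longleftrightarrow> (y, x) \<in> tree_pairs k n"
    using False by (simp add: dir_def)
  also have "\<dots> \<longleftrightarrow> (\<exists>b v w. x = glue b v \<and> y = glue b w \<and>
     valid k x \<and> valid k y \<and> length x \<le> n \<and> length y \<le> n \<and>
     (if odd (length b) then prefix w v else prefix v w))"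
    unfolding tree_pairs_def by blast
  finally show ?thesis using False by (simp cong: if_cong) blast
qed

text \<open>Everything grown through child \<open>i\<close> of \<open>glue b w\<close> in the tree
  with root \<open>b\<close>, including all trees appended later.\<close>

definition branch :: "elem \<Rightarrow> nat list \<Rightarrow> nat \<Rightarrow> elem set" where
  "branch b w i = {b @ [w @ i # v] @ z | v z. True}"

lemma glue_in_branch_iff:
  "glue b' v \<in> branch b w i \<longleftrightarrow> b' \<in> branch b w i \<or> (b' = b \<and> prefix (w @ [i]) v)"
proof (cases "v = []")
  case False
  have "b' @ [v] \<in> branch b w i \<longleftrightarrow> (\<exists>u z. b' @ [v] = b @ [w @ i # u] @ z)"
    by (simp add: branch_def)
  also have "\<dots> \<longleftrightarrow> (\<exists>u. b' = b \<and> v = w @ i # u) \<or> (\<exists>u z. b' = b @ [w @ i # u] @ z)"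
  proof
    assume "\<exists>u z. b' @ [v] = b @ [w @ i # u] @ z"
    then obtain u z where *: "b' @ [v] = b @ [w @ i # u] @ z" by blast
    show "(\<exists>u. b' = b \<and> v = w @ i # u) \<or> (\<exists>u z. b' = b @ [w @ i # u] @ z)"
      using * by (cases z rule: rev_cases) (auto simp flip: append_assoc)
  qed (auto intro: exI[of _ "[]"])
  finally show ?thesis using False by (auto simp: glue_def branch_def prefix_def)
qed (auto simp: branch_def)

lemma branch_disjoint: "x \<in> branch b w i \<Longrightarrow> x \<in> branch b w j \<Longrightarrow> i = j"
  by (auto simp: branch_def)

lemma tree_pairs_from_branch:
  assumes "(x, y) \<in> dir (odd (length b)) (tree_pairs k n)" "x \<in> branch b w i"
  shows "y \<in> branch b w i"
  using assms by (auto simp: dir_tree_pairs glue_in_branch_iff dest: prefix_order.trans)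

text \<open>A tree rooted inside the branch lies entirely in it, so an entering step must take place
  in the tree of \<open>b\<close>, starting at a prefix of \<open>w\<close>.\<close>

lemma tree_pairs_into_branch:
  assumes "(x, y) \<in> dir (odd (length b)) (tree_pairs k n)" "x \<notin> branch b w i" "y \<in> branch b w i"
  shows "\<exists>v. prefix v w \<and> x = glue b v"
proof -
  obtain v u where *: "x = glue b v" "y = glue b u" "prefix v u" "prefix (w @ [i]) u" "\<not> prefix (w @ [i]) v"
    using assms by (auto simp: dir_tree_pairs glue_in_branch_iff)
  then have "prefix v (w @ [i])" "v \<noteq> w @ [i]" using prefix_same_cases by blast+
  then have "prefix v w" by simp
  then show ?thesis using * by blast
qed

lemma from_branch:
  assumes "(x, y) \<in> dir (odd (length b)) ((tree_pairs k n)\<^sup>+)" "x \<in> branch b w i"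
  shows "y \<in> branch b w i"
  using assms unfolding dir_trancl
  by (induction rule: trancl_induct) (auto dest: tree_pairs_from_branch)

text \<open>A generating sequence that ends in the branch has an entering step, and the start of
  that step reaches \<open>glue b w\<close> directly.\<close>

lemma into_branch:
  assumes "(x, y) \<in> dir (odd (length b)) ((tree_pairs k n)\<^sup>+)" "x \<notin> branch b w i" "y \<in> branch b w i"
    and "valid k (glue b w)" "length (glue b w) \<le> n"
  shows "(x, glue b w) \<in> dir (odd (length b)) ((tree_pairs k n)\<^sup>+)"
proof -
  have *: "(u, glue b w) \<in> dir (odd (length b)) (tree_pairs k n)"
    if "(u, z) \<in> dir (odd (length b)) (tree_pairs k n)" "u \<notin> branch b w i" "z \<in> branch b w i" for u z
    using tree_pairs_into_branch[OF that] that(1) assms(4,5) by (auto simp: dir_tree_pairs)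
  show ?thesis using assms(1-3) unfolding dir_trancl
  proof (induction rule: trancl_induct)
    case (base z)
    then show ?case using * by blast
  next
    case (step y z)
    then show ?case using *[of y z] by (meson trancl.trancl_into_trancl)
  qed
qed

text \<open>Going up from an up element never leaves its uptree, and dually for down elements; the
  central element counts as up.\<close>

lemma even_length_dir_trancl:
  assumes "(x, y) \<in> dir (even (length x)) ((tree_pairs k n)\<^sup>+)"
  shows "even (length y) = even (length x)"
  using assms unfolding dir_trancl
proof (induction rule: trancl_induct)
  case (base y)
  then show ?case by (auto simp: dir_tree_pairs length_glue split: if_splits)
next
  case (step y z)
  then show ?case by (auto simp: dir_tree_pairs length_glue split: if_splits)
qed

subsection \<open>Unused colours on chains\<close>

text \<open>The colour of the starting node is left out. Hence \<open>w = []\<close> may represent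
  the root of the tree at \<open>b\<close>, although \<open>b @ [[]]\<close> is not a name.\<close>

fun chain_cols :: "(elem \<Rightarrow> nat) \<Rightarrow> nat \<Rightarrow> elem \<Rightarrow> nat list \<Rightarrow> nat \<Rightarrow> nat set set" where
  "chain_cols c k b w 0 = {{}}"
| "chain_cols c k b w (Suc h) =
     (\<Union>i<k. insert (c (b @ [w @ [i]])) ` chain_cols c k b (w @ [i]) h)"

text \<open>Colour sets of the maximal chains strictly above (\<open>d\<close>) or below (\<open>\<not> d\<close>) \<open>e\<close> inside one
  appended tree. Elements of even length are up elements, so they continue upwards in the tree in
  which they were created and downwards in a fresh tree.  For \<open>e = []\<close> and \<open>d\<close> the height is 0,
  hence the value of \<open>last []\<close> is irrelevant.\<close>

definition chains :: "(elem \<Rightarrow> nat) \<Rightarrow> nat \<Rightarrow> bool \<Rightarrow> elem \<Rightarrow> nat set set" where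
  "chains c k d e =
     (let h = nat (if d then int k - rho k e else rho k e - 1)
      in if d = even (length e) then chain_cols c k (butlast e) (last e) h else chain_cols c k e [] h)"

lemma chains_snoc:
  assumes "valid k (b @ [w])"
  shows "chains c k (odd (length b)) (b @ [w]) = chain_cols c k b w (hgt k b - length w)"
  using assms valid_rho[OF assms]
  by (auto simp: chains_def hgt_def valid_snoc_iff nat_diff_distrib' algebra_simps intro!: arg_cong[of _ _ "chain_cols c k b w"])

text \<open>Unifies continuing in the tree where \<open>e\<close> was created with starting the
  fresh tree at \<open>e\<close>, where \<open>w = []\<close>. Only the central element in the
  upward direction has no tree.\<close>

lemma chains_cases:
  assumes "valid k e"
  obtains "e = []" "d" "chains c k d e = {{}}"
  | b w where "e = glue b w" "odd (length b) = d" "length b \<le> length e" "valid k b"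
    "set w \<subseteq> {..<k}" "length w \<le> hgt k b" "chains c k d e = chain_cols c k b w (hgt k b - length w)"
proof (cases "d = even (length e)")
  case True
  show thesis
  proof (cases e rule: rev_cases)
    case Nil
    then show thesis using True that(1) by (simp add: chains_def)
  next
    case (snoc b w)
    then have "w \<noteq> []" using assms by (simp add: valid_snoc_iff)
    then have "e = glue b w" using snoc by (simp add: glue_def)
    moreover have "odd (length b) = d" using snoc True by simp
    moreover have "length b \<le> length e" using snoc by simp
    moreover have "valid k b" "set w \<subseteq> {..<k}" "length w \<le> hgt k b"
      using assms calculation(1) valid_glue_iff by auto
    moreover have "chains c k d e = chain_cols c k b w (hgt k b - length w)"
      using chains_snoc[of k b w c] assms snoc calculation(2) by simp
    ultimately show thesis using that(2) by blast
  qed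
next
  case False
  then have "chains c k d e = chain_cols c k e [] (hgt k e)"
    by (auto simp: chains_def hgt_def)
  then show thesis using that(2)[of e "[]"] assms False by auto
qed

section \<open>Chains and placements under a proper colouring\<close>

locale coloured =
  fixes k :: nat and c :: "elem \<Rightarrow> nat"
  assumes k: "1 \<le> k" and proper: "proper_coloring (Tposet k) c"
begin

lemma Tposet_eq: "Tposet k = (tree_pairs k k)\<^sup>+"
  unfolding Tposet_def by (rule stage_eq[OF k])

lemma trans_Tposet: "trans (dir d (Tposet k))"
  by (simp add: Tposet_eq trans_dir)

lemma antisym_Tposet: "(x, y) \<in> dir d (Tposet k) \<Longrightarrow> (y, x) \<in> dir d (Tposet k) \<Longrightarrow> x = y"
  using rho_strict_mono[of x y k k] rho_strict_mono[of y x k k]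
  by (auto simp: Tposet_eq dir_def split: if_splits)

lemma refl_Tposet: "valid k x \<Longrightarrow> length x \<le> k \<Longrightarrow> (x, x) \<in> dir d (Tposet k)"
  using tree_pairs_refl[of k x k] by (auto simp: Tposet_eq dir_def)

lemma colour_neq: "(x, y) \<in> dir d (Tposet k) \<Longrightarrow> x \<noteq> y \<Longrightarrow> c x \<noteq> c y"
  using proper by (auto simp: proper_coloring_def dir_def split: if_splits dest: not_sym)

lemma le_extend:
  assumes "valid k (glue b (w @ u))" "length b < k"
  shows "(glue b w, glue b (w @ u)) \<in> dir (odd (length b)) (Tposet k)"
proof -
  have "valid k (glue b w)" using assms by (auto simp: valid_glue_iff)
  then have "(glue b w, glue b (w @ u)) \<in> dir (odd (length b)) (tree_pairs k k)"
    using assms unfolding dir_tree_pairs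
    by (intro exI[of _ b] exI[of _ w] exI[of _ "w @ u"]) (auto simp: length_glue)
  then show ?thesis unfolding Tposet_eq dir_trancl by blast
qed

text \<open>Elements of a chain are comparable, so properness makes their colours distinct and fixes
  the cardinality.\<close>

lemma chain_cols_above:
  assumes "valid k b" "length b < k" "set w \<subseteq> {..<k}" "length w + h \<le> hgt k b"
    and "K \<in> chain_cols c k b w h"
  shows "finite K \<and> card K = h \<and>
    (\<forall>x\<in>K. \<exists>z. (glue b w, z) \<in> dir (odd (length b)) (Tposet k) \<and> z \<noteq> glue b w \<and> c z = x)"
  using assms(3-)
proof (induction h arbitrary: w K)
  case (Suc h)
  then obtain i K' where i: "i < k" and K: "K = insert (c (b @ [w @ [i]])) K'"
    and K': "K' \<in> chain_cols c k b (w @ [i]) h" by auto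
  let ?z = "glue b (w @ [i])" and ?L = "dir (odd (length b)) (Tposet k)"
  have z: "b @ [w @ [i]] = ?z" by (simp add: glue_def)
  have IH: "finite K' \<and> card K' = h \<and> (\<forall>x\<in>K'. \<exists>z. (?z, z) \<in> ?L \<and> z \<noteq> ?z \<and> c z = x)"
    using Suc.prems i K' by (intro Suc.IH) auto
  have le: "(glue b w, ?z) \<in> ?L"
    using Suc.prems i assms(1,2) by (intro le_extend) (auto simp: valid_glue_iff)
  have ne: "?z \<noteq> glue b w" by (auto simp: glue_def)
  have "c ?z \<notin> K'" using IH colour_neq by metis
  moreover have "\<exists>z. (glue b w, z) \<in> ?L \<and> z \<noteq> glue b w \<and> c z = x" if "x \<in> K'" for x
  proof -
    have "\<exists>z. (?z, z) \<in> ?L \<and> z \<noteq> ?z \<and> c z = x" using IH that by simp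
    then obtain z where z: "(?z, z) \<in> ?L" "z \<noteq> ?z" "c z = x" by metis
    have "(glue b w, z) \<in> ?L" using le z(1) transD[OF trans_Tposet] by blast
    moreover have "z \<noteq> glue b w" using antisym_Tposet[OF le] z ne by blast
    ultimately show ?thesis using z by blast
  qed
  ultimately show ?case using IH le ne K z by auto
qed simp

lemma chains_above:
  assumes "valid k e" "length e < k" "K \<in> chains c k d e"
  shows "finite K" and "card K = nat (if d then int k - rho k e else rho k e - 1)"
    and "x \<in> K \<Longrightarrow> \<exists>z. (e, z) \<in> dir d (Tposet k) \<and> z \<noteq> e \<and> c z = x"
proof -
  have "finite K \<and> card K = nat (if d then int k - rho k e else rho k e - 1) \<and>
    (x \<in> K \<longrightarrow> (\<exists>z. (e, z) \<in> dir d (Tposet k) \<and> z \<noteq> e \<and> c z = x))"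
    using assms(1)
  proof (cases rule: chains_cases[of k e d c])
    case 1
    then show ?thesis using assms(3) by auto
  next
    case (2 b w)
    have "nat (if d then int k - rho k e else rho k e - 1) = hgt k b - length w"
      using 2(1,2,4,6) valid_rho[OF 2(4)] by (auto simp: rho_glue hgt_def)
    then show ?thesis using 2 assms chain_cols_above[of b w "hgt k b - length w" K] by auto
  qed
  then show "finite K" "card K = nat (if d then int k - rho k e else rho k e - 1)"
    "x \<in> K \<Longrightarrow> \<exists>z. (e, z) \<in> dir d (Tposet k) \<and> z \<noteq> e \<and> c z = x" by auto
qed

text \<open>An element behind \<open>e\<close> is comparable to the whole chain ahead of
  \<open>e\<close>. With the direction reversed, this is why colours placed ahead of a vertex spare
  the chains behind it.\<close>

lemma not_in_chains:
  assumes "valid k e" "length e < k" "K \<in> chains c k d e" "(z, e) \<in> dir d (Tposet k)"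
  shows "c z \<notin> K"
proof
  assume "c z \<in> K"
  then obtain y where y: "(e, y) \<in> dir d (Tposet k)" "y \<noteq> e" "c y = c z"
    using chains_above(3)[OF assms(1-3)] by blast
  have "(z, y) \<in> dir d (Tposet k)" using assms(4) y(1) transD[OF trans_Tposet] by blast
  then show False using colour_neq y antisym_Tposet assms(4) by metis
qed

text \<open>The two chains and \<open>e\<close> together carry exactly \<open>k\<close> distinct
  colours, and all of these that are used lie in \<open>C\<close>.\<close>

lemma card_unused_chains:
  assumes "valid k e" "length e < k" "K1 \<in> chains c k d e" "K2 \<in> chains c k (\<not> d) e"
    and "finite C" "c e \<in> C"
  shows "k \<le> card (K1 - C) + card (K2 - C) + card C"
proof -
  note a1 = chains_above[OF assms(1-3)] and a2 = chains_above[OF assms(1,2,4)]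
  have ee: "(e, e) \<in> dir d' (Tposet k)" for d' using refl_Tposet assms(1,2) by simp
  have "c e \<notin> K1" "c e \<notin> K2" using not_in_chains assms ee by blast+
  moreover have "K1 \<inter> K2 = {}"
  proof (rule ccontr)
    assume "K1 \<inter> K2 \<noteq> {}"
    then obtain x where x: "x \<in> K1" "x \<in> K2" by blast
    obtain z where z: "(e, z) \<in> dir (\<not> d) (Tposet k)" "c z = x" using a2(3)[OF x(2)] by blast
    then show False using not_in_chains[OF assms(1-3)] x(1) by (auto simp: dir_not)
  qed
  ultimately have "card (insert (c e) (K1 \<union> K2)) = Suc (card K1 + card K2)"
    using a1(1) a2(1) by (simp add: card_Un_disjoint)
  also have "\<dots> = k" using a1(2) a2(2) valid_rho[OF assms(1)] by auto
  finally have "k \<le> card ((K1 - C) \<union> (K2 - C) \<union> C)"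
    using card_mono[of "(K1 - C) \<union> (K2 - C) \<union> C" "insert (c e) (K1 \<union> K2)"] a1(1) a2(1) assms(5,6)
    by auto
  also have "\<dots> \<le> card (K1 - C) + card (K2 - C) + card C"
    by (meson add_le_mono card_Un_le le_refl le_trans)
  finally show ?thesis .
qed

text \<open>Going up the tree, the number of unused colours on the remaining chains drops in steps of at
  most one, so there is a last element from which it is still above \<open>a\<close>.\<close>

lemma exists_exact_unused:
  assumes "\<forall>K\<in>chain_cols c k b w h. Suc a \<le> card (insert (c (b @ [w])) K - C)"
  shows "\<exists>u. set u \<subseteq> {..<k} \<and> length u \<le> h \<and> c (b @ [w @ u]) \<notin> C \<and>
    (\<forall>K\<in>chain_cols c k b (w @ u) (h - length u). a \<le> card (K - C)) \<and>
    (\<exists>K\<in>chain_cols c k b (w @ u) (h - length u). card (K - C) \<le> a)"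
  using assms
proof (induction h arbitrary: w)
  case 0
  \<comment> \<open>The only chain here is empty, so the single colour of the node is all that can
    be counted.\<close>
  then have "c (b @ [w]) \<notin> C" "a = 0" by (auto simp: insert_Diff_if split: if_splits)
  then show ?case by (intro exI[of _ "[]"]) auto
next
  case (Suc h)
  show ?case
  proof (cases "\<exists>K\<in>chain_cols c k b w (Suc h). card (K - C) \<le> a")
    case True
    have le: "card (insert x K - C) \<le> Suc (card (K - C))" for x :: nat and K
      using card_insert_le_m1[of "Suc (card (K - C))" "K - C" x] by (simp add: insert_Diff_if)
    obtain K where K: "K \<in> chain_cols c k b w (Suc h)" "card (K - C) \<le> a" using True by blast
    have "c (b @ [w]) \<notin> C"
    proof
      assume "c (b @ [w]) \<in> C"
      then have "insert (c (b @ [w])) K - C = K - C" by blast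
      then show False using Suc.prems K by fastforce
    qed
    moreover have "a \<le> card (K - C)" if "K \<in> chain_cols c k b w (Suc h)" for K
      using Suc.prems that le[of "c (b @ [w])" K] by fastforce
    ultimately show ?thesis using True by (intro exI[of _ "[]"]) auto
  next
    case False
    have "0 < k" using k by simp
    have "Suc a \<le> card (insert (c (b @ [w @ [0]])) K - C)" if "K \<in> chain_cols c k b (w @ [0]) h" for K
    proof -
      have "insert (c (b @ [w @ [0]])) K \<in> chain_cols c k b w (Suc h)"
        using that \<open>0 < k\<close> by auto
      then show ?thesis using False by fastforce
    qed
    then obtain u where "set u \<subseteq> {..<k} \<and> length u \<le> h \<and> c (b @ [(w @ [0]) @ u]) \<notin> C \<and>
      (\<forall>K\<in>chain_cols c k b ((w @ [0]) @ u) (h - length u). a \<le> card (K - C)) \<and>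
      (\<exists>K\<in>chain_cols c k b ((w @ [0]) @ u) (h - length u). card (K - C) \<le> a)"
      using Suc.IH[of "w @ [0]"] by blast
    then show ?thesis using \<open>0 < k\<close> by (intro exI[of _ "0 # u"]) auto
  qed
qed

text \<open>Pigeonhole: the \<open>k\<close> branches are disjoint.\<close>

lemma exists_fresh_branch:
  assumes "finite X" "card X < k"
  shows "\<exists>i<k. X \<inter> branch b w i = {}"
proof (rule ccontr)
  assume "\<not> ?thesis"
  then have "\<forall>i\<in>{..<k}. \<exists>x. x \<in> X \<inter> branch b w i" by blast
  then obtain g where g: "\<forall>i\<in>{..<k}. g i \<in> X \<inter> branch b w i" by metis
  then have "inj_on g {..<k}" by (metis IntD2 branch_disjoint inj_onI)
  moreover have "g ` {..<k} \<subseteq> X" using g by blast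
  ultimately have "card {..<k} \<le> card X" using card_inj_on_le assms(1) by blast
  then show False using assms(2) by simp
qed

text \<open>Enter a branch free of \<open>X\<close>, then stop where the count is exact. In
  direction \<open>d\<close> the branch is never left and is entered only from elements that reach
  \<open>e\<close>, so \<open>e'\<close> acquires no unwanted comparabilities with
  \<open>X\<close>.\<close>

lemma exists_placement:
  assumes e: "valid k e" "length e < k" and X: "finite X" "card X < k"
    and unused: "\<forall>K\<in>chains c k d e. Suc a \<le> card (K - C)"
  shows "\<exists>e'. valid k e' \<and> length e' \<le> Suc (length e) \<and> even (length e') = d \<and>
    (e, e') \<in> dir d (Tposet k) \<and> c e' \<notin> C \<and>
    (\<forall>x\<in>X. ((x, e') \<in> dir d (Tposet k) \<longrightarrow> (x, e) \<in> dir d (Tposet k)) \<and>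
      (e', x) \<notin> dir d (Tposet k)) \<and>
    (\<forall>K\<in>chains c k d e'. a \<le> card (K - C)) \<and> (\<exists>K\<in>chains c k d e'. card (K - C) \<le> a)"
  using e(1)
proof (cases rule: chains_cases[of k e d c])
  case 1
  then show ?thesis using unused by simp
next
  case (2 b w)
  obtain h where h: "hgt k b - length w = Suc h"
    using 2(7) unused by (cases "hgt k b - length w") auto
  obtain i where i: "i < k" "X \<inter> branch b w i = {}" using exists_fresh_branch[OF X] by blast
  have "Suc a \<le> card (insert (c (b @ [w @ [i]])) K - C)" if "K \<in> chain_cols c k b (w @ [i]) h" for K
    using unused 2(7) h that i(1) by auto
  then obtain u where u: "set u \<subseteq> {..<k}" "length u \<le> h" "c (b @ [(w @ [i]) @ u]) \<notin> C"
    "\<forall>K\<in>chain_cols c k b ((w @ [i]) @ u) (h - length u). a \<le> card (K - C)"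
    "\<exists>K\<in>chain_cols c k b ((w @ [i]) @ u) (h - length u). card (K - C) \<le> a"
    using exists_exact_unused[of b "w @ [i]" h a C] by blast
  let ?e' = "b @ [w @ i # u]"
  have e': "?e' = glue b (w @ i # u)" by (simp add: glue_def)
  have val: "valid k ?e'" using 2 h i u unfolding e' valid_glue_iff by auto
  have "hgt k b - length (w @ i # u) = h - length u" using h by simp
  then have ch: "chains c k d ?e' = chain_cols c k b (w @ i # u) (h - length u)"
    using chains_snoc[OF val, of c] 2(2) by simp
  have br: "?e' \<in> branch b w i" by (auto simp: branch_def)
  have lb: "length b < k" using 2(3) e(2) by simp
  show ?thesis
  proof (intro exI[of _ ?e'] conjI ballI impI)
    show "valid k ?e'" by (rule val)
    show "length ?e' \<le> Suc (length e)" using 2(3) by simp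
    show "even (length ?e') = d" using 2(2) by simp
    show "(e, ?e') \<in> dir d (Tposet k)" using le_extend[of b w "i # u"] val lb 2(1,2) e' by simp
    show "c ?e' \<notin> C" using u(3) by simp
    show "(x, e) \<in> dir d (Tposet k)" if "x \<in> X" "(x, ?e') \<in> dir d (Tposet k)" for x
      using into_branch[of x ?e' b k k w i] that i br e 2(1,2) unfolding Tposet_eq by auto
    show "(?e', x) \<notin> dir d (Tposet k)" if "x \<in> X" for x
      using from_branch[of ?e' x b k k w i] that i br 2(2) unfolding Tposet_eq by auto
    show "a \<le> card (K - C)" if "K \<in> chains c k d ?e'" for K using u(4) ch that by simp
    show "\<exists>K\<in>chains c k d ?e'. card (K - C) \<le> a" using u(5) ch by simp
  qed
qed

end

subsection \<open>The greedy embedding\<close>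

lemma crossing_edge:
  assumes "(x, y) \<in> E\<^sup>*" "x \<in> P" "y \<notin> P"
  obtains s t where "s \<in> P" "t \<notin> P" "(s, t) \<in> E"
proof -
  have "\<exists>s t. s \<in> P \<and> t \<notin> P \<and> (s, t) \<in> E" using assms
    by (induction rule: rtrancl_induct) blast+
  then show thesis using that by blast
qed

lemma connected_insert:
  assumes "\<forall>x\<in>P. \<forall>y\<in>P. (x, y) \<in> (Restr E P)\<^sup>*" "sym E" "s \<in> P" "(s, t) \<in> E"
  shows "\<forall>x\<in>insert t P. \<forall>y\<in>insert t P. (x, y) \<in> (Restr E (insert t P))\<^sup>*"
proof -
  let ?R = "Restr E (insert t P)"
  have old: "(x, y) \<in> ?R\<^sup>*" if "x \<in> P" "y \<in> P" for x y
    by (rule rtrancl_mono[THEN subsetD, of "Restr E P"]) (use assms(1) that in auto)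
  have "(s, t) \<in> ?R" "(t, s) \<in> ?R" using assms by (auto dest: symD)
  then have "(x, t) \<in> ?R\<^sup>*" "(t, x) \<in> ?R\<^sup>*" if "x \<in> P" for x
    using old[OF that assms(3)] old[OF assms(3) that]
    by (meson rtrancl.rtrancl_into_rtrancl converse_rtrancl_into_rtrancl)+
  with old show ?thesis by auto
qed

lemma card_Diff_le_Suc_card_Diff_insert: "card (K - C) \<le> Suc (card (K - insert x C))"
proof (cases "finite (K - C)")
  case True
  then have "card (K - C) \<le> card (insert x (K - insert x C))"
    by (intro card_mono) (auto intro: finite_subset[OF _ True])
  also have "\<dots> \<le> Suc (card (K - insert x C))"
    by (rule card_insert_le_m1) auto
  finally show ?thesis .
qed simp

locale embedding = coloured k c for k c +
  fixes T :: "'a rel"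
  assumes tree: "tree_poset T" and card_T: "card (Field T) = k"
begin

lemma partial_order_dir: "Partial_order (dir d T)"
  using tree by (auto simp: tree_poset_def dir_def)

lemma finite_T: "finite (Field T)"
  using tree by (auto simp: tree_poset_def)

lemma trans_T: "(x, y) \<in> dir d T \<Longrightarrow> (y, z) \<in> dir d T \<Longrightarrow> (x, z) \<in> dir d T"
  using partial_order_dir[of d] by (auto simp: order_on_defs dest: transD)

lemma refl_T: "x \<in> Field T \<Longrightarrow> (x, x) \<in> dir d T"
  using partial_order_dir[of d] by (auto simp: order_on_defs refl_on_def)

lemma Field_T: "(x, y) \<in> dir d T \<Longrightarrow> x \<in> Field T \<and> y \<in> Field T"
  by (auto simp: dir_def Field_def split: if_splits)

definition pending :: "'a set \<Rightarrow> bool \<Rightarrow> 'a \<Rightarrow> 'a set" where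
  "pending P d x = {v \<in> Field T - P. (x, v) \<in> dir d T}"

lemma finite_pending: "finite (pending P d x)"
  using finite_T by (simp add: pending_def)

definition up :: "('a \<Rightarrow> elem) \<Rightarrow> 'a \<Rightarrow> bool" where
  "up \<phi> x = even (length (\<phi> x))"

text \<open>An element that is active still has unplaced elements beyond it in its own appended tree. The
  elements beyond it in that tree are placed before anything else, so the active elements form a
  chain; the colours used meanwhile lie beyond it and hence spare the chains on its other side.\<close>

definition partial_embedding :: "'a set \<Rightarrow> ('a \<Rightarrow> elem) \<Rightarrow> bool" where
  "partial_embedding P \<phi> \<longleftrightarrow>
     P \<subseteq> Field T \<and> P \<noteq> {} \<and> (\<forall>x\<in>P. \<forall>y\<in>P. (x, y) \<in> (Restr (hasse_edges T) P)\<^sup>*) \<and>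
     inj_on (c \<circ> \<phi>) P \<and> (\<forall>x\<in>P. valid k (\<phi> x) \<and> length (\<phi> x) < card P) \<and>
     (\<forall>x\<in>P. \<forall>y\<in>P. (x, y) \<in> T \<longleftrightarrow> (\<phi> x, \<phi> y) \<in> Tposet k) \<and>
     (\<forall>x\<in>P. \<forall>K\<in>chains c k (up \<phi> x) (\<phi> x).
        card (pending P (up \<phi> x) x) \<le> card (K - c ` \<phi> ` P)) \<and>
     (\<forall>x\<in>P. \<forall>K\<in>chains c k (\<not> up \<phi> x) (\<phi> x).
        k \<le> card (K - c ` \<phi> ` P) + card (pending P (up \<phi> x) x) + card P) \<and>
     (\<forall>x\<in>P. \<forall>y\<in>P. pending P (up \<phi> x) x \<noteq> {} \<longrightarrow> pending P (up \<phi> y) y \<noteq> {} \<longrightarrow>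
        up \<phi> x = up \<phi> y \<and> ((x, y) \<in> T \<or> (y, x) \<in> T))"

lemma partial_embeddingD:
  assumes "partial_embedding P \<phi>"
  shows "P \<subseteq> Field T" "P \<noteq> {}" "\<forall>x\<in>P. \<forall>y\<in>P. (x, y) \<in> (Restr (hasse_edges T) P)\<^sup>*"
    "inj_on (c \<circ> \<phi>) P" "\<And>x. x \<in> P \<Longrightarrow> valid k (\<phi> x)" "\<And>x. x \<in> P \<Longrightarrow> length (\<phi> x) < card P"
    "\<And>x y d. x \<in> P \<Longrightarrow> y \<in> P \<Longrightarrow> (x, y) \<in> dir d T \<longleftrightarrow> (\<phi> x, \<phi> y) \<in> dir d (Tposet k)"
    "\<And>x K. x \<in> P \<Longrightarrow> K \<in> chains c k (up \<phi> x) (\<phi> x) \<Longrightarrow>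
       card (pending P (up \<phi> x) x) \<le> card (K - c ` \<phi> ` P)"
    "\<And>x K. x \<in> P \<Longrightarrow> K \<in> chains c k (\<not> up \<phi> x) (\<phi> x) \<Longrightarrow>
       k \<le> card (K - c ` \<phi> ` P) + card (pending P (up \<phi> x) x) + card P"
    "\<And>x y d. x \<in> P \<Longrightarrow> y \<in> P \<Longrightarrow> pending P (up \<phi> x) x \<noteq> {} \<Longrightarrow>
       pending P (up \<phi> y) y \<noteq> {} \<Longrightarrow> up \<phi> x = up \<phi> y \<and> ((x, y) \<in> dir d T \<or> (y, x) \<in> dir d T)"
  using assms unfolding partial_embedding_def by (simp_all add: dir_def) blast

text \<open>Nothing is pending above a maximal vertex, and each chain below the central element has
  \<open>k - 1\<close> colours different from its own.\<close>

lemma exists_partial_embedding: "\<exists>P \<phi>. partial_embedding P \<phi>"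
proof -
  have po: "Partial_order T" using tree by (simp add: tree_poset_def)
  have "Field T \<noteq> {}" using card_T k by auto
  then obtain m where m: "m \<in> Field T" "\<And>y. y \<in> Field T \<Longrightarrow> (m, y) \<in> T \<Longrightarrow> y = m"
    using exists_maximal[OF po finite_T subset_refl] by metis
  have val: "valid k []" using k by (rule valid.Nil)
  have p: "pending {m} True m = {}" using m(2) by (auto simp: pending_def dir_def)
  have ref: "(m, m) \<in> T" "([], []) \<in> Tposet k"
    using refl_T[OF m(1), of True] refl_Tposet[OF val, of True] by (auto simp: dir_def)
  have "k \<le> card (K - {c []}) + 1" if K: "K \<in> chains c k False []" for K
  proof -
    have "c [] \<notin> K"
      using not_in_chains[OF val _ K, of "[]"] ref(2) k by (simp add: dir_def)
    then show ?thesis using chains_above(2)[OF val _ K] k by simp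
  qed
  then have "partial_embedding {m} (\<lambda>_. [])"
    unfolding partial_embedding_def using m(1) val p ref by (auto simp: up_def)
  then show ?thesis by blast
qed

text \<open>If some vertex is active, the last active one is served first, with a nearest pending
  vertex. Otherwise any edge leaving \<open>P\<close> must run against the direction of its placed
  end \<open>s\<close>, where the colours suffice for all unplaced vertices.\<close>

lemma exists_attachable:
  assumes S: "partial_embedding P \<phi>" and P: "P \<noteq> Field T"
  shows "\<exists>s\<in>P. \<exists>t\<in>Field T - P. \<exists>d. covers (dir d T) t s \<and>
    (\<forall>x\<in>P. pending P (up \<phi> x) x \<noteq> {} \<longrightarrow> up \<phi> x = d \<and> (x, s) \<in> dir d T) \<and>
    (\<forall>K\<in>chains c k d (\<phi> s). card (pending P d t) \<le> card (K - c ` \<phi> ` P))"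
proof -
  note D = partial_embeddingD[OF S]
  define A where "A = {x \<in> P. pending P (up \<phi> x) x \<noteq> {}}"
  show ?thesis
  proof (cases "A = {}")
    case False
    then obtain a where a: "a \<in> A" by blast
    define d where "d = up \<phi> a"
    have upA: "up \<phi> x = d" if "x \<in> A" for x
      using D(10)[of x a] that a unfolding A_def d_def by blast
    have "A \<subseteq> Field (dir d T)" using D(1) by (auto simp: A_def)
    then obtain s where s: "s \<in> A" "\<And>y. y \<in> A \<Longrightarrow> (s, y) \<in> dir d T \<Longrightarrow> y = s"
      using exists_maximal[OF partial_order_dir _ _ False, of d] finite_T by auto
    have top: "(x, s) \<in> dir d T" if "x \<in> A" for x
      using D(10)[of x s d] that s unfolding A_def by blast
    have sP: "s \<in> P" using s by (simp add: A_def)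
    have "pending P d s \<noteq> {}" "pending P d s \<subseteq> Field (dir (\<not> d) T)"
      using s(1) upA[OF s(1)] unfolding A_def by (simp, auto simp: pending_def)
    then obtain t where t: "t \<in> pending P d s"
      "\<And>y. y \<in> pending P d s \<Longrightarrow> (y, t) \<in> dir d T \<Longrightarrow> y = t"
      using exists_maximal[OF partial_order_dir _ _ \<open>pending P d s \<noteq> {}\<close>, of "\<not> d"] finite_T
      unfolding dir_not Field_dir by metis
    have tP: "t \<in> Field T - P" "(s, t) \<in> dir d T" using t(1) by (auto simp: pending_def)
    then have "s \<noteq> t" using sP by blast
    \<comment> \<open>This cover will be \<open>s\<close>: it is placed because \<open>t\<close> is
      nearest to \<open>s\<close>, it points in the same direction as \<open>s\<close> and has
      \<open>t\<close> pending, so it is active, and \<open>s\<close> is the last active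
      vertex.\<close>
    then obtain z where z: "(s, z) \<in> dir d T" "covers (dir d T) t z"
      using exists_lower_cover[OF partial_order_dir _ tP(2)] finite_T by auto
    have zt: "(z, t) \<in> dir d T" "z \<noteq> t" using z(2) by (auto simp: covers_def)
    have "z \<in> P"
    proof (rule ccontr)
      assume "z \<notin> P"
      then have "z \<in> pending P d s" using z(1) Field_T by (auto simp: pending_def)
      then show False using t(2) zt by blast
    qed
    moreover have "up \<phi> z = d"
    proof -
      have "(\<phi> s, \<phi> z) \<in> dir (even (length (\<phi> s))) ((tree_pairs k k)\<^sup>+)"
        using D(7)[OF sP \<open>z \<in> P\<close>, of d] z(1) upA[OF s(1)] by (simp add: Tposet_eq up_def)
      from even_length_dir_trancl[OF this] show ?thesis using upA[OF s(1)] by (simp add: up_def)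
    qed
    moreover have "t \<in> pending P d z" using tP zt by (auto simp: pending_def)
    ultimately have "z \<in> A" by (auto simp: A_def)
    then have "z = s" using s(2) z(1) by blast
    show ?thesis
    proof (intro bexI exI conjI ballI impI)
      show "s \<in> P" "t \<in> Field T - P" "covers (dir d T) t s" using sP tP z(2) \<open>z = s\<close> by auto
      show "up \<phi> x = d" "(x, s) \<in> dir d T" if "x \<in> P" "pending P (up \<phi> x) x \<noteq> {}" for x
        using that upA[of x] top[of x] by (simp_all add: A_def)
      show "card (pending P d t) \<le> card (K - c ` \<phi> ` P)" if "K \<in> chains c k d (\<phi> s)" for K
      proof -
        have "pending P d t \<subseteq> pending P d s"
          using trans_T[OF tP(2)] by (auto simp: pending_def)
        then have "card (pending P d t) \<le> card (pending P d s)"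
          by (intro card_mono finite_pending)
        also have "\<dots> \<le> card (K - c ` \<phi> ` P)" using D(8)[OF sP] that upA[OF s(1)] by simp
        finally show ?thesis .
      qed
    qed
  next
    case True
    obtain x y where xy: "x \<in> P" "y \<in> Field T" "y \<notin> P" using D(1,2) P by blast
    then have "(x, y) \<in> (hasse_edges T)\<^sup>*"
      using D(1) tree by (auto simp: tree_poset_def graph_tree_def)
    then obtain s t where st: "s \<in> P" "t \<notin> P" "(s, t) \<in> hasse_edges T"
      using crossing_edge xy by metis
    then obtain d where d: "covers (dir d T) t s"
    proof -
      have "covers (dir True T) t s \<or> covers (dir False T) t s"
        using st(3) by (auto simp: hasse_edges_def dir_def covers_converse)
      then show thesis using that by blast
    qed
    have tT: "t \<in> Field T" "(s, t) \<in> dir d T" using d Field_T by (auto simp: covers_def)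
    have none: "pending P (up \<phi> x) x = {}" if "x \<in> P" for x using that True by (auto simp: A_def)
    have "d = (\<not> up \<phi> s)"
    proof (rule ccontr)
      assume "d \<noteq> (\<not> up \<phi> s)"
      then have "t \<in> pending P (up \<phi> s) s" using tT st by (auto simp: pending_def)
      then show False using none st(1) by blast
    qed
    show ?thesis
    proof (intro bexI exI conjI ballI impI)
      show "s \<in> P" "t \<in> Field T - P" "covers (dir d T) t s" using st tT d by auto
      show "up \<phi> x = d" "(x, s) \<in> dir d T" if "x \<in> P" "pending P (up \<phi> x) x \<noteq> {}" for x
        using that none by blast+
      show "card (pending P d t) \<le> card (K - c ` \<phi> ` P)" if "K \<in> chains c k d (\<phi> s)" for K
      proof -
        have "card (pending P d t) \<le> card (Field T - P)"
          using finite_T by (intro card_mono) (auto simp: pending_def)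
        also have "\<dots> = k - card P" using D(1) finite_T card_T by (simp add: card_Diff_subset finite_subset)
        also have "\<dots> \<le> card (K - c ` \<phi> ` P)"
          using D(9)[OF st(1)] that none[OF st(1)] \<open>d = (\<not> up \<phi> s)\<close> by fastforce
        finally show ?thesis .
      qed
    qed
  qed
qed

lemma partial_embedding_extend:
  assumes S: "partial_embedding P \<phi>" and P: "P \<noteq> Field T"
  shows "\<exists>t \<phi>'. t \<in> Field T - P \<and> partial_embedding (insert t P) \<phi>'"
proof -
  note D = partial_embeddingD[OF S]
  obtain s t d where s: "s \<in> P" and tP: "t \<in> Field T - P" and cov: "covers (dir d T) t s"
    and active: "\<And>x. x \<in> P \<Longrightarrow> pending P (up \<phi> x) x \<noteq> {} \<Longrightarrow> up \<phi> x = d \<and> (x, s) \<in> dir d T"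
    and unused: "\<And>K. K \<in> chains c k d (\<phi> s) \<Longrightarrow> card (pending P d t) \<le> card (K - c ` \<phi> ` P)"
    using exists_attachable[OF assms] by blast
  have t: "t \<in> Field T" "t \<notin> P" using tP by auto
  define P' where "P' = insert t P"
  define C where "C = c ` \<phi> ` P"
  define a where "a = card (pending P' d t)"
  have finP: "finite P" using D(1) finite_T finite_subset by blast
  have cardP: "card P < k"
    using D(1) P finite_T card_T psubset_card_mono[of "Field T" P] by blast
  have cardP': "card P' = Suc (card P)" using t finP by (simp add: P'_def)
  have cardC: "card C = card P"
    using card_image[OF D(4)] by (simp add: C_def image_comp)
  have finC: "finite C" using finP by (simp add: C_def)
  have pend': "pending P' d' x = pending P d' x - {t}" for d' x
    by (auto simp: pending_def P'_def)
  \<comment> \<open>Before its placement \<open>t\<close> is pending relative to itself, which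
    accounts for the extra one in \<open>Suc a\<close>.\<close>
  have "t \<in> pending P d t" using t refl_T by (auto simp: pending_def)
  then have "card (pending P d t) = Suc a"
    using finite_pending card_Suc_Diff1 by (metis a_def pend')
  with unused have unused': "\<forall>K\<in>chains c k d (\<phi> s). Suc a \<le> card (K - C)"
    by (simp add: C_def)
  have X: "finite (\<phi> ` P)" "card (\<phi> ` P) < k"
    using finP card_image_le[OF finP, of \<phi>] cardP by auto
  have len_P: "length (\<phi> x) < k" if "x \<in> P" for x using D(6)[OF that] cardP by simp
  obtain e where e: "valid k e" "length e \<le> Suc (length (\<phi> s))" "even (length e) = d"
    "(\<phi> s, e) \<in> dir d (Tposet k)" "c e \<notin> C"
    and fresh: "\<forall>x\<in>\<phi> ` P. ((x, e) \<in> dir d (Tposet k) \<longrightarrow> (x, \<phi> s) \<in> dir d (Tposet k)) \<and>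
      (e, x) \<notin> dir d (Tposet k)"
    and exact: "\<forall>K\<in>chains c k d e. a \<le> card (K - C)" "\<exists>K\<in>chains c k d e. card (K - C) \<le> a"
    using exists_placement[OF D(5)[OF s] len_P[OF s] X unused'] by blast
  define \<phi>' where "\<phi>' = \<phi>(t := e)"
  have \<phi>t: "\<phi>' t = e" and \<phi>P: "\<And>x. x \<in> P \<Longrightarrow> \<phi>' x = \<phi> x" using t by (auto simp: \<phi>'_def)
  have upt: "up \<phi>' t = d" and upP: "\<And>x. x \<in> P \<Longrightarrow> up \<phi>' x = up \<phi> x"
    using e(3) \<phi>t \<phi>P by (auto simp: up_def)
  have C': "c ` \<phi>' ` P' = insert (c e) C" using \<phi>t \<phi>P by (auto simp: P'_def C_def image_iff)
  \<comment> \<open>Each placement adds at most one word, so names never outgrow the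
    \<open>k\<close> steps of the construction.\<close>
  have len_e: "length e < card P'" using e(2) D(6)[OF s] cardP' by simp
  have len_k: "length e < k" using e(2) D(6)[OF s] cardP by simp
  have attach: "(x, t) \<in> dir d T \<longleftrightarrow> (x, s) \<in> dir d T" "(t, x) \<notin> dir d T" if "x \<in> P" for x
    using tree_poset_attach[OF tree_poset_dir[OF tree] _ s t(2) cov that] D(3)
    by (simp_all add: hasse_edges_dir)
  have e_iff: "(\<phi> x, e) \<in> dir d (Tposet k) \<longleftrightarrow> (x, t) \<in> dir d T" if "x \<in> P" for x
    using e(4) fresh attach(1)[OF that] D(7)[OF that s, of d] that transD[OF trans_Tposet] by blast
  have iso: "(x, y) \<in> T \<longleftrightarrow> (\<phi>' x, \<phi>' y) \<in> Tposet k" if xy: "x \<in> P'" "y \<in> P'" for x y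
  proof -
    have "(x, y) \<in> dir d T \<longleftrightarrow> (\<phi>' x, \<phi>' y) \<in> dir d (Tposet k)" if xy: "x \<in> P'" "y \<in> P'" for x y
    proof -
      consider "x \<in> P" "y \<in> P" | "x \<in> P" "y = t" | "x = t" "y \<in> P" | "x = t" "y = t"
        using xy by (auto simp: P'_def)
      then show ?thesis
      proof cases
        case 1
        then show ?thesis using D(7) \<phi>P by simp
      next
        case 2
        then show ?thesis using e_iff \<phi>P \<phi>t by simp
      next
        case 3
        then show ?thesis using attach(2) fresh \<phi>P \<phi>t by simp
      next
        case 4
        then show ?thesis using refl_T t refl_Tposet e(1) len_k \<phi>t by simp
      qed
    qed
    from this[OF xy] this[OF xy(2,1)] show ?thesis by (auto simp: dir_def split: if_splits)
  qed
  have near: "card (pending P' (up \<phi>' x) x) \<le> card (K - insert (c e) C)"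
    if x: "x \<in> P'" and K: "K \<in> chains c k (up \<phi>' x) (\<phi>' x)" for x K
  proof (cases "x = t")
    case True
    then have K': "K \<in> chains c k d e" using K upt \<phi>t by simp
    have "c e \<notin> K" using not_in_chains[OF e(1) len_k K'] refl_Tposet e(1) len_k by simp
    then have "K - insert (c e) C = K - C" by blast
    then show ?thesis using exact(1) K' True upt by (simp add: a_def)
  next
    case False
    then have xP: "x \<in> P" using x by (simp add: P'_def)
    have K': "K \<in> chains c k (up \<phi> x) (\<phi> x)" using K \<phi>P upP xP by simp
    have old: "card (pending P (up \<phi> x) x) \<le> card (K - C)" using D(8)[OF xP K'] by (simp add: C_def)
    show ?thesis
    proof (cases "pending P (up \<phi> x) x = {}")
      case True
      then show ?thesis using pend' upP[OF xP] by simp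
    next
      case False
      \<comment> \<open>\<open>t\<close> was pending for every active \<open>x\<close>, so the
        possible loss of one colour is matched by one pending vertex fewer.\<close>
      from active[OF xP False] have "up \<phi> x = d" "(x, t) \<in> dir d T" using attach(1)[OF xP] by auto
      then have "t \<in> pending P (up \<phi> x) x" using t by (simp add: pending_def)
      then have "Suc (card (pending P' (up \<phi> x) x)) = card (pending P (up \<phi> x) x)"
        using pend' card_Suc_Diff1[OF finite_pending] by simp
      moreover have "card (K - C) \<le> Suc (card (K - insert (c e) C))"
        by (rule card_Diff_le_Suc_card_Diff_insert)
      ultimately show ?thesis using old upP[OF xP] by simp
    qed
  qed
  have far: "k \<le> card (K - insert (c e) C) + card (pending P' (up \<phi>' x) x) + card P'"
    if x: "x \<in> P'" and K: "K \<in> chains c k (\<not> up \<phi>' x) (\<phi>' x)" for x K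
  proof (cases "x = t")
    case True
    then have K2: "K \<in> chains c k (\<not> d) e" using K upt \<phi>t by simp
    obtain K1 where K1: "K1 \<in> chains c k d e" "card (K1 - C) \<le> a" using exact(2) by blast
    have "card (K1 - insert (c e) C) \<le> card (K1 - C)"
      using chains_above(1)[OF e(1) len_k K1(1)] by (intro card_mono) auto
    moreover have "card (insert (c e) C) = card P'" using e(5) finC cardC cardP' by simp
    moreover have "k \<le> card (K1 - insert (c e) C) + card (K - insert (c e) C) + card (insert (c e) C)"
      using card_unused_chains[OF e(1) len_k K1(1) K2] finC by simp
    ultimately show ?thesis using K1(2) True upt by (simp add: a_def)
  next
    case False
    then have xP: "x \<in> P" using x by (simp add: P'_def)
    have K': "K \<in> chains c k (\<not> up \<phi> x) (\<phi> x)" using K \<phi>P upP xP by simp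
    have old: "k \<le> card (K - C) + card (pending P (up \<phi> x) x) + card P"
      using D(9)[OF xP K'] by (simp add: C_def)
    have drop: "card (K - C) \<le> Suc (card (K - insert (c e) C))"
      by (rule card_Diff_le_Suc_card_Diff_insert)
    show ?thesis
    proof (cases "pending P (up \<phi> x) x = {}")
      case True
      then show ?thesis using old drop pend' upP[OF xP] cardP' by simp
    next
      case False
      from active[OF xP False] have xt: "up \<phi> x = d" "(x, t) \<in> dir d T" using attach(1)[OF xP] by auto
      then have "t \<in> pending P (up \<phi> x) x" using t by (simp add: pending_def)
      then have "Suc (card (pending P' (up \<phi> x) x)) = card (pending P (up \<phi> x) x)"
        using pend' card_Suc_Diff1[OF finite_pending] by simp
      \<comment> \<open>The new element lies ahead of \<open>\<phi> x\<close>, so the chain behind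
        loses no colour; the shrinking pending set is offset by the growth of
        \<open>P\<close>.\<close>
      moreover have "(e, \<phi> x) \<in> dir (\<not> up \<phi> x) (Tposet k)"
        using e_iff[OF xP] xt by (simp add: dir_not)
      then have "c e \<notin> K" using not_in_chains[OF D(5)[OF xP] len_P[OF xP] K'] by blast
      then have "K - insert (c e) C = K - C" by blast
      ultimately show ?thesis using old upP[OF xP] cardP' by simp
    qed
  qed
  have chain: "up \<phi>' x = up \<phi>' y \<and> ((x, y) \<in> T \<or> (y, x) \<in> T)"
    if xy: "x \<in> P'" "y \<in> P'" "pending P' (up \<phi>' x) x \<noteq> {}" "pending P' (up \<phi>' y) y \<noteq> {}" for x y
  proof -
    \<comment> \<open>A vertex active after the placement is \<open>t\<close> itself or was active
      before, and then lies before \<open>t\<close>.\<close>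
    have act: "x = t \<or> x \<in> P \<and> pending P (up \<phi> x) x \<noteq> {} \<and> up \<phi> x = d \<and> (x, t) \<in> dir d T"
      if "x \<in> P'" "pending P' (up \<phi>' x) x \<noteq> {}" for x
    proof (cases "x = t")
      case False
      then have xP: "x \<in> P" using that(1) by (simp add: P'_def)
      then have "pending P (up \<phi> x) x \<noteq> {}" using that(2) upP pend' by auto
      then show ?thesis using active[OF xP] attach(1)[OF xP] xP by blast
    qed simp
    have "(t, t) \<in> dir d T" using refl_T t by simp
    then have "up \<phi>' x = up \<phi>' y \<and> ((x, y) \<in> dir d T \<or> (y, x) \<in> dir d T)"
      using act[OF xy(1,3)] act[OF xy(2,4)] D(10)[of x y d] upt upP by metis
    then show ?thesis by (auto simp: dir_def split: if_splits)
  qed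
  have conn: "\<forall>x\<in>P'. \<forall>y\<in>P'. (x, y) \<in> (Restr (hasse_edges T) P')\<^sup>*"
  proof -
    have "(s, t) \<in> hasse_edges T"
      using cov hasse_edges_dir[of d T] by (auto simp: hasse_edges_def)
    then show ?thesis unfolding P'_def by (rule connected_insert[OF D(3) sym_hasse_edges s])
  qed
  have inj: "inj_on (c \<circ> \<phi>') P'"
  proof -
    have "inj_on (c \<circ> \<phi>') P" using D(4) \<phi>P by (simp add: inj_on_def)
    moreover have "(c \<circ> \<phi>') ` P = C" using \<phi>P by (auto simp: C_def image_iff)
    ultimately show ?thesis using e(5) \<phi>t t(2) by (simp add: P'_def)
  qed
  have "valid k (\<phi>' x) \<and> length (\<phi>' x) < card P'" if "x \<in> P'" for x
    using that D(5,6)[of x] e(1) len_e \<phi>t \<phi>P[of x] cardP' by (auto simp: P'_def)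
  then have "partial_embedding P' \<phi>'"
    unfolding partial_embedding_def C'
    using D(1) t conn inj iso near far chain by (auto simp: P'_def)
  then show ?thesis using t by (auto simp: P'_def)
qed

lemma exists_full_embedding: "\<exists>\<phi>. partial_embedding (Field T) \<phi>"
proof -
  have "\<exists>\<phi>. partial_embedding (Field T) \<phi>" if "partial_embedding P \<phi>" for P \<phi>
    using that
  proof (induction "card (Field T - P)" arbitrary: P \<phi> rule: less_induct)
    case less
    show ?case
    proof (cases "P = Field T")
      case False
      then obtain t \<phi>' where t: "t \<in> Field T - P" "partial_embedding (insert t P) \<phi>'"
        using partial_embedding_extend[OF less.prems] by blast
      have "card (Field T - insert t P) < card (Field T - P)"
        using t(1) finite_T by (intro psubset_card_mono) auto
      then show ?thesis using less.hyps t(2) by blast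
    qed (use less.prems in blast)
  qed
  then show ?thesis using exists_partial_embedding by blast
qed

lemma exists_rainbow_copy: "\<exists>S. is_copy S T (Tposet k) \<and> inj_on c S"
proof -
  obtain \<phi> where S: "partial_embedding (Field T) \<phi>" using exists_full_embedding by blast
  note D = partial_embeddingD[OF S]
  let ?S = "\<phi> ` Field T"
  have sub: "?S \<subseteq> Field (Tposet k)"
    using D(5,6) card_T by (auto simp: Tposet_eq Field_tree_pairs intro: less_imp_le)
  have "(x, x) \<in> Restr (Tposet k) ?S" if "x \<in> ?S" for x
    using that sub refl_Tposet[of x True] by (auto simp: Tposet_eq Field_tree_pairs dir_def)
  then have "?S \<subseteq> Field (Restr (Tposet k) ?S)" by (blast intro: FieldI1)
  then have "Field (Restr (Tposet k) ?S) = ?S" by (auto simp: Field_def)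
  moreover have "inj_on \<phi> (Field T)" using D(4) by (rule inj_on_imageI2)
  ultimately have "poset_iso \<phi> T (Restr (Tposet k) ?S)"
    using D(7)[of _ _ True] by (auto simp: poset_iso_def bij_betw_def dir_def)
  then have "is_copy ?S T (Tposet k)" using sub by (auto simp: is_copy_def)
  moreover have "inj_on c ?S" using D(4) by (rule inj_on_imageI)
  ultimately show ?thesis by blast
qed

end

theorem theorem3p2:
  fixes k :: nat and T :: "'a rel"
  assumes "1 \<le> k"
    and "tree_poset T"
    and "card (Field T) = k"
  shows "rainbow_forces (Tposet k) T"
  unfolding rainbow_forces_def
proof (intro allI impI)
  fix c :: "elem \<Rightarrow> nat"
  assume "proper_coloring (Tposet k) c"
  then interpret embedding k c T using assms by unfold_locales
  show "\<exists>S. is_copy S T (Tposet k) \<and> inj_on c S" by (rule exists_rainbow_copy)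
qed

end
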